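(* Consider the simplified model of membership inference described in the context, with an arbitrary number $C$ of classes, $S$ examples per class, in-class covariance $\Sigma$, and infinitely many shadow models. Fix a target example $(\boldsymbol{x},y)$ with $\boldsymbol{x}^T\Sigma\boldsymbol{x}>0$ and $\langle \boldsymbol{x},\boldsymbol{x}-\boldsymbol{m}_{\boldsymbol{x}}\rangle\neq 0$, where $\boldsymbol{m}_{\boldsymbol{x}}$ is the true mean of class $y$. Let the threshold of the LiRA test be chosen so that its per-example false positive rate is $\mathrm{FPR}_{\mathrm{LiRA}}(\boldsymbol{x})\in(0,1)$ (held fixed as $S$ varies), and let $\mathrm{TPR}_{\mathrm{LiRA}}(\boldsymbol{x})$ be the corresponding per-example true positive rate. Then $$\log\big(\mathrm{TPR}_{\mathrm{LiRA}}(\boldsymbol{x})-\mathrm{FPR}_{\mathrm{LiRA}}(\boldsymbol{x})\big) = -\frac12\log S-\frac12\Phi^{-1}\big(\mathrm{FPR}_{\mathrm{LiRA}}(\boldsymbol{x})\big)^2+\log\frac{|\langle \boldsymbol{x},\boldsymbol{x}-\boldsymbol{m}_{\boldsymbol{x}}\rangle|}{\sqrt{\boldsymbol{x}^T\Sigma\boldsymbol{x}}\,\sqrt{2\pi}}+\log(1+\xi(S)),$$ where $\xi(S)=O(1/\sqrt S)$ as $S\to\infty$. In particular, for large $S$, $$\log\big(\mathrm{TPR}_{\mathrm{LiRA}}(\boldsymbol{x})-\mathrm{FPR}_{\mathrm{LiRA}}(\boldsymbol{x})\big) \approx -\frac12\log S-\frac12\Phi^{-1}\big(\mathrm{FPR}_{\mathrm{LiRA}}(\boldsymbol{x})\big)^2+\log\frac{|\langle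 \boldsymbol{x},\boldsymbol{x}-\boldsymbol{m}_{\boldsymbol{x}}\rangle|}{\sqrt{\boldsymbol{x}^T\Sigma\boldsymbol{x}}\,\sqrt{2\pi}},$$ where $\approx$ means that the difference of the two sides tends to $0$ as $S\to\infty$.
   Context: $\Phi$ is the standard normal cdf. Simplified model. There are $C$ classes with true class means $\boldsymbol{m}_1,\dots,\boldsymbol{m}_C$ on the unit sphere of a high-dimensional Euclidean space, pairwise orthogonal. Examples of class $c$ are distributed as $\mathcal N(\boldsymbol{m}_c,\Sigma)$, independently. A training (target) dataset $\mathcal D_{\mathrm{target}}$ consists of $S$ examples of each class (so it has $CS$ elements). The model trained on it is given by the per-class empirical means $\hat{\boldsymbol{m}}_c$ of the $S$ examples of class $c$; the score of an example $(\boldsymbol{x},y)$ is $t_{\boldsymbol{x}}=\langle \boldsymbol{x},\hat{\boldsymbol{m}}_y\rangle$. If $(\boldsymbol{x},y)\notin\mathcal D_{\mathrm{target}}$ (OUT), $\hat{\boldsymbol{m}}_y$ is the mean of $S$ i.i.d. samples of $\mathcal N(\boldsymbol{m}_y,\Sigma)$; if $(\boldsymbol{x},y)\in\mathcal D_{\mathrm{target}}$ (IN), $\hat{\boldsymbol{m}}_y$ is the mean of $\boldsymbol{x}$ and $S-1$ i.i.d. samples of $\mathcal N(\boldsymbol{m}_y,\Sigma)$. LiRA. The attack forms the likelihood ratio $$\mathrm{LR}(\boldsymbol{x})=\frac{\mathcal N(t_{\boldsymbol{x}};\hat\mu_{\mathrm{in}},\hat\sigma^2)}{\mathcal N(t_{\boldsymbol{x}};\hat\mu_{\mathrm{out}},\hat\sigma^2)}$$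 (ratio of normal densities), and declares membership iff $\mathrm{LR}(\boldsymbol{x})\ge\tau$, $\tau$ a threshold. $\mathrm{TPR}_{\mathrm{LiRA}}(\boldsymbol{x})=\Pr(\mathrm{LR}(\boldsymbol{x})\ge\tau\mid(\boldsymbol{x},y)\in\mathcal D_{\mathrm{target}})$ and $\mathrm{FPR}_{\mathrm{LiRA}}(\boldsymbol{x})=\Pr(\mathrm{LR}(\boldsymbol{x})\ge\tau\mid(\boldsymbol{x},y)\notin\mathcal D_{\mathrm{target}})$, with $(\boldsymbol{x},y)$ fixed and the probability over the rest of the dataset. With infinitely many shadow models (drawn from the true data distribution), $\hat\mu_{\mathrm{in}},\hat\mu_{\mathrm{out}}$ equal the true IN/OUT means of $t_{\boldsymbol{x}}$ and $\hat\sigma$ equals its true standard deviation. Standing shared-scale assumption: the IN and OUT distributions of $t_{\boldsymbol{x}}$ are taken to have a common standard deviation $\sigma(\boldsymbol{x})$, equal to the OUT one, $\sigma(\boldsymbol{x})^2=\frac1S\boldsymbol{x}^T\Sigma\boldsymbol{x}$ (the exact IN variance $\frac1S(1-\frac1S)\boldsymbol{x}^T\Sigma\boldsymbol{x}$ is identified with it for large $S$). Thus $t_{\boldsymbol{x}}$ is normal with variance $\sigma(\boldsymbol{x})^2$ and with mean $\mu_{\mathrm{in}}$ (IN) or $\mu_{\mathrm{out}}$ (OUT), the means being the true IN/OUT means. *)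

theory Defs
  imports "HOL-Probability.Probability" "HOL-Library.Landau_Symbols"
begin

definition normal_law :: "real \<Rightarrow> real \<Rightarrow> real measure" where
  "normal_law \<mu> \<sigma> =
     (if \<sigma> = 0 then return borel \<mu> else density lborel (normal_density \<mu> \<sigma>))"

definition covariance_matrix :: "real^'n^'n \<Rightarrow> bool" where
  "covariance_matrix V \<longleftrightarrow> transpose V = V \<and> (\<forall>u. 0 \<le> u \<bullet> (V *v u))"

text \<open>
  The multivariate normal distribution with mean \<open>m\<close> and covariance matrix \<open>V\<close>, which may be
  singular: every linear functional is univariate normal (possibly degenerate).
\<close>

definition multivariate_normal :: "(real^'n) measure \<Rightarrow> real^'n \<Rightarrow> real^'n^'n \<Rightarrow> bool" where
  "multivariate_normal M m V \<longleftrightarrow>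
     prob_space M \<and> sets M = sets borel \<and>
     (\<forall>u. distr M borel (\<lambda>z. u \<bullet> z) = normal_law (u \<bullet> m) (sqrt (u \<bullet> (V *v u))))"

definition std_normal_cdf :: "real \<Rightarrow> real" where
  "std_normal_cdf = cdf std_normal_distribution"

text \<open>
  A data set maps \<open>(c, i)\<close> to the \<open>i\<close>-th example of class \<open>c\<close>; \<open>N c\<close> is the law of an example of
  class \<open>c\<close>. In the IN case the target example \<open>(x, y)\<close> occupies the position \<open>(y, 0)\<close>, i.e. the
  law there is the point mass at \<open>x\<close>, and all other examples are drawn afresh.
\<close>

definition out_data ::
  "nat \<Rightarrow> (nat \<Rightarrow> (real^'n) measure) \<Rightarrow> nat \<Rightarrow> (nat \<times> nat \<Rightarrow> real^'n) measure" where
  "out_data C N S = Pi\<^sub>M ({..<C} \<times> {..<S}) (\<lambda>(c, i). N c)"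

definition in_data ::
  "nat \<Rightarrow> (nat \<Rightarrow> (real^'n) measure) \<Rightarrow> real^'n \<Rightarrow> nat \<Rightarrow> nat \<Rightarrow> (nat \<times> nat \<Rightarrow> real^'n) measure" where
  "in_data C N x y S =
     Pi\<^sub>M ({..<C} \<times> {..<S}) (\<lambda>(c, i). if (c, i) = (y, 0) then return borel x else N c)"

definition class_mean :: "nat \<Rightarrow> (nat \<times> nat \<Rightarrow> real^'n) \<Rightarrow> nat \<Rightarrow> real^'n" where
  "class_mean S D c = (1 / real S) *\<^sub>R (\<Sum>i<S. D (c, i))"

definition score :: "real^'n \<Rightarrow> nat \<Rightarrow> nat \<Rightarrow> (nat \<times> nat \<Rightarrow> real^'n) \<Rightarrow> real" where
  "score x y S D = x \<bullet> class_mean S D y"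

definition mu_out :: "nat \<Rightarrow> (nat \<Rightarrow> (real^'n) measure) \<Rightarrow> real^'n \<Rightarrow> nat \<Rightarrow> nat \<Rightarrow> real" where
  "mu_out C N x y S = (\<integral>D. score x y S D \<partial>out_data C N S)"

definition mu_in :: "nat \<Rightarrow> (nat \<Rightarrow> (real^'n) measure) \<Rightarrow> real^'n \<Rightarrow> nat \<Rightarrow> nat \<Rightarrow> real" where
  "mu_in C N x y S = (\<integral>D. score x y S D \<partial>in_data C N x y S)"

text \<open>The shared scale is the standard deviation of the score in the OUT case.\<close>

definition score_sd :: "nat \<Rightarrow> (nat \<Rightarrow> (real^'n) measure) \<Rightarrow> real^'n \<Rightarrow> nat \<Rightarrow> nat \<Rightarrow> real" where
  "score_sd C N x y S = sqrt (\<integral>D. (score x y S D - mu_out C N x y S)\<^sup>2 \<partial>out_data C N S)"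

text \<open>
  With infinitely many shadow models the estimated parameters in the likelihood ratio are the
  true ones.
\<close>

definition lira_ratio ::
  "nat \<Rightarrow> (nat \<Rightarrow> (real^'n) measure) \<Rightarrow> real^'n \<Rightarrow> nat \<Rightarrow> nat \<Rightarrow> real \<Rightarrow> real" where
  "lira_ratio C N x y S t =
     normal_density (mu_in C N x y S) (score_sd C N x y S) t /
     normal_density (mu_out C N x y S) (score_sd C N x y S) t"

definition FPR_LiRA ::
  "nat \<Rightarrow> (nat \<Rightarrow> (real^'n) measure) \<Rightarrow> real^'n \<Rightarrow> nat \<Rightarrow> nat \<Rightarrow> real \<Rightarrow> real" where
  "FPR_LiRA C N x y S \<tau> =
     measure (out_data C N S)
       {D \<in> space (out_data C N S). \<tau> \<le> lira_ratio C N x y S (score x y S D)}"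

text \<open>
  By the shared-scale assumption, the law of the score in the IN case is taken to be normal with
  the exact IN mean and the OUT standard deviation. (Its exact variance is smaller than the OUT
  variance by a factor of \<open>1 - 1 / S\<close>.)
\<close>

definition TPR_LiRA ::
  "nat \<Rightarrow> (nat \<Rightarrow> (real^'n) measure) \<Rightarrow> real^'n \<Rightarrow> nat \<Rightarrow> nat \<Rightarrow> real \<Rightarrow> real" where
  "TPR_LiRA C N x y S \<tau> =
     measure (normal_law (mu_in C N x y S) (score_sd C N x y S))
       {t. \<tau> \<le> lira_ratio C N x y S t}"

end

theory Submission
  imports Defs "HOL-Real_Asymp.Real_Asymp"
begin

text \<open>
  In units of the shared scale \<open>\<sigma> = sqrt (x \<bullet> \<Sigma>x / S)\<close>, the IN and OUT laws of the score are unit-variance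
  normals at distance \<open>a = \<bar>\<langle>x, x - m\<^sub>x\<rangle>\<bar> / sqrt (S (x \<bullet> \<Sigma>x))\<close>, since replacing one sample by \<open>x\<close> moves the
  mean by \<open>\<langle>x, x - m\<^sub>x\<rangle> / S\<close>. The likelihood ratio is monotone in the score, so the test is a
  half-line and \<open>TPR = \<Phi>(\<Phi>\<inverse>(FPR) + a)\<close>. The mean value theorem gives
  \<open>TPR - FPR = a \<phi>(t)\<close> with \<open>t\<close> within \<open>a\<close> of \<open>\<Phi>\<inverse>(FPR)\<close>; as the normal density \<open>\<phi>\<close> is Lipschitz,
  \<open>\<phi>(t)\<close> agrees with \<open>\<phi>(\<Phi>\<inverse>(FPR))\<close> up to a relative error of order \<open>a\<close>.
\<close>

section \<open>Standard normal cdf and density; half-lines and likelihood ratios of normals\<close>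

text \<open>The density is continuous, so it has an antiderivative \<open>F\<close> on the whole
  line; the cdf has the same increments as \<open>F\<close>, and the mean value theorem applies to
  \<open>F\<close>. This turns the gap between TPR and FPR into a shift times a density
  value.\<close>

lemma std_normal_cdf_mvt:
  assumes "a < b"
  obtains \<xi> where "a < \<xi>" "\<xi> < b" "std_normal_cdf b - std_normal_cdf a = (b - a) * std_normal_density \<xi>"
proof -
  interpret real_distribution std_normal_distribution
    by (rule real_dist_normal_dist)
  have cont: "isCont std_normal_density t" for t
    unfolding normal_density_def by (intro continuous_intros) auto
  obtain F where F: "(F has_vector_derivative std_normal_density t) (at t)" for t
    using einterval_antiderivative[of "-\<infinity>" "\<infinity>" std_normal_density] cont by auto
  have "std_normal_cdf b - std_normal_cdf a = measure std_normal_distribution {a<..b}"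
    unfolding std_normal_cdf_def using assms by (rule cdf_diff_eq)
  also have "\<dots> = (\<integral>t. indicator {a<..b} t \<partial>std_normal_distribution)"
    by simp
  also have "\<dots> = (\<integral>t. std_normal_density t *\<^sub>R indicator {a<..b} t \<partial>lborel)"
    by (rule integral_density) auto
  \<comment> \<open>The cdf gives a half-open interval and the fundamental theorem of calculus wants
    a closed one; the endpoint \<open>a\<close> is a null set.\<close>
  also have "\<dots> = (\<integral>t. indicator {a..b} t *\<^sub>R std_normal_density t \<partial>lborel)"
  proof (rule integral_cong_AE)
    show "AE t in lborel. std_normal_density t *\<^sub>R indicator {a<..b} t =
        indicator {a..b} t *\<^sub>R std_normal_density t"
      using AE_lborel_singleton[of a] by eventually_elim (auto split: split_indicator)
  qed auto
  also have "\<dots> = F b - F a"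
    using assms F cont
    by (intro integral_FTC_atLeastAtMost)
       (auto intro: has_vector_derivative_at_within continuous_at_imp_continuous_on)
  finally have eq: "std_normal_cdf b - std_normal_cdf a = F b - F a" .
  have "\<And>t. DERIV F t :> std_normal_density t"
    using F by (simp add: has_real_derivative_iff_has_vector_derivative)
  with MVT2[OF assms, of F std_normal_density] eq that show ?thesis by auto
qed

text \<open>Injectivity is the point: it makes \<open>inv std_normal_cdf\<close> a true left inverse
  of the cdf.\<close>

lemma std_normal_cdf_strict_mono: "strict_mono std_normal_cdf"
proof (rule strict_monoI)
  fix a b :: real assume "a < b"
  then obtain \<xi> where "std_normal_cdf b - std_normal_cdf a = (b - a) * std_normal_density \<xi>"
    by (rule std_normal_cdf_mvt)
  then show "std_normal_cdf a < std_normal_cdf b"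
    using \<open>a < b\<close> normal_density_pos[of 1 0 \<xi>] mult_pos_pos[of "b - a" "std_normal_density \<xi>"]
    by linarith
qed

text \<open>The derivative at \<open>t\<close> is \<open>- t * std_normal_density t\<close>, of
  absolute value at most 1 because \<open>\<bar>t\<bar> \<le> exp (t\<^sup>2 / 2)\<close> and
  \<open>1 \<le> sqrt (2 * pi)\<close>.\<close>

lemma std_normal_density_lipschitz:
  "\<bar>std_normal_density a - std_normal_density b\<bar> \<le> \<bar>a - b\<bar>"
proof -
  have "norm (std_normal_density a - std_normal_density b) \<le> 1 * norm (a - b)"
  proof (rule field_differentiable_bound[of UNIV])
    fix t :: real
    have "((\<lambda>t. exp (- t\<^sup>2 / 2)) has_field_derivative - t * exp (- t\<^sup>2 / 2)) (at t)"
      by (auto intro!: derivative_eq_intros)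
    from DERIV_cmult[OF this, of "1 / sqrt (2 * pi)"]
    show "(std_normal_density has_field_derivative - t * std_normal_density t) (at t within UNIV)"
      by (simp add: std_normal_density_def[abs_def] mult.left_commute)
    have "\<bar>t\<bar> \<le> 1 + t\<^sup>2 / 2"
      using zero_le_power2[of "\<bar>t\<bar> - 1"] by (simp add: power2_diff)
    also have "\<dots> \<le> exp (t\<^sup>2 / 2)"
      by (rule exp_ge_add_one_self)
    finally have "\<bar>t\<bar> * exp (- (t\<^sup>2 / 2)) \<le> 1"
      by (simp add: exp_minus field_simps)
    moreover have "1 \<le> sqrt (2 * pi)"
      using pi_gt3 by simp
    ultimately have "\<bar>t\<bar> * exp (- (t\<^sup>2 / 2)) \<le> sqrt (2 * pi)"
      by (rule order_trans)
    then show "norm (- t * std_normal_density t) \<le> 1"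
      by (simp add: std_normal_density_def abs_mult field_simps)
  qed auto
  then show ?thesis by simp
qed

text \<open>Choosing the sign of the scale in the standardization turns both orientations of the
  half-line into a lower tail.\<close>

lemma measure_normal_halfline:
  assumes \<sigma>: "\<sigma> > 0" and a: "a \<noteq> 0"
  shows "measure (density lborel (normal_density \<mu> \<sigma>)) {t. b \<le> a * ((t - \<mu>) / \<sigma>)} =
    std_normal_cdf (- b / \<bar>a\<bar>)"
proof -
  interpret real_distribution std_normal_distribution
    by (rule real_dist_normal_dist)
  define s where "s = - sgn a * \<sigma>"
  have s: "s \<noteq> 0" "\<bar>s\<bar> = \<sigma>" "a * (s / \<sigma>) = - \<bar>a\<bar>"
    using \<sigma> a by (auto simp: s_def sgn_if)
  have "distributed std_normal_distribution lborel (\<lambda>t. t) std_normal_density"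
    by (auto simp: distributed_def distr_id2)
  \<comment> \<open>The image under \<open>\<mu> + s * t\<close> has standard deviation
    \<open>\<bar>s\<bar> = \<sigma>\<close>, so a negative \<open>s\<close> yields the same normal
    law.\<close>
  from normal_density_affine[OF this _ s(1), of \<mu>]
  have "distributed std_normal_distribution lborel (\<lambda>t. \<mu> + s * t) (normal_density \<mu> \<sigma>)"
    by (simp add: s)
  then have "density lborel (normal_density \<mu> \<sigma>) = distr std_normal_distribution lborel (\<lambda>t. \<mu> + s * t)"
    by (simp add: distributed_def)
  then have "measure (density lborel (normal_density \<mu> \<sigma>)) {t. b \<le> a * ((t - \<mu>) / \<sigma>)} =
     measure std_normal_distribution ((\<lambda>t. \<mu> + s * t) -` {t. b \<le> a * ((t - \<mu>) / \<sigma>)} \<inter>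
       space std_normal_distribution)"
    by (simp only:) (rule measure_distr; measurable)
  also have "(\<lambda>t. \<mu> + s * t) -` {t. b \<le> a * ((t - \<mu>) / \<sigma>)} \<inter> space std_normal_distribution =
      {.. - b / \<bar>a\<bar>}"
  proof -
    have "b \<le> a * (s * t / \<sigma>) \<longleftrightarrow> t \<le> - b / \<bar>a\<bar>" for t
    proof -
      have "a * (s * t / \<sigma>) = - \<bar>a\<bar> * t"
        using s(3) by (metis mult.assoc times_divide_eq_left)
      moreover have "t \<le> - b / \<bar>a\<bar> \<longleftrightarrow> t * \<bar>a\<bar> \<le> - b"
        using a by (intro pos_le_divide_eq) simp
      ultimately show ?thesis by (simp add: mult.commute) linarith
    qed
    then show ?thesis by auto
  qed
  finally show ?thesis
    by (simp add: std_normal_cdf_def cdf_def2)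
qed

text \<open>With equal scales the terms quadratic in \<open>t\<close> cancel, so the log-ratio is
  affine in the standardized score. Its slope is the standardized distance of the means.\<close>

lemma normal_likelihood_ratio:
  assumes "\<sigma> > 0"
  shows "normal_density \<mu>' \<sigma> t / normal_density \<mu> \<sigma> t =
    exp ((\<mu>' - \<mu>) / \<sigma> * ((t - \<mu>) / \<sigma>) - ((\<mu>' - \<mu>) / \<sigma>)\<^sup>2 / 2)"
proof -
  have "- ((t - \<mu>')\<^sup>2 / (2 * \<sigma>\<^sup>2)) - - ((t - \<mu>)\<^sup>2 / (2 * \<sigma>\<^sup>2)) =
    (\<mu>' - \<mu>) / \<sigma> * ((t - \<mu>) / \<sigma>) - ((\<mu>' - \<mu>) / \<sigma>)\<^sup>2 / 2"
    using assms by (simp add: field_simps power2_eq_square)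
  then show ?thesis
    using assms by (simp add: normal_density_def flip: exp_diff)
qed

section \<open>Coordinates of product measures; linear functionals of a multivariate normal\<close>

text \<open>The joint law of the coordinates is the product measure itself, which is the product of
  their marginals. The criterion used for this asks for a nonempty index set, hence the case
  split.\<close>

lemma indep_vars_PiM_components:
  assumes M: "\<And>i. i \<in> I \<Longrightarrow> prob_space (M i)"
  shows "prob_space.indep_vars (PiM I M) M (\<lambda>i \<omega>. \<omega> i) I"
proof (cases "I = {}")
  case True
  interpret prob_space "PiM I M" by (rule prob_space_PiM[OF M])
  show ?thesis unfolding indep_vars_def indep_sets_def using True by auto
next
  case False
  interpret prob_space "PiM I M" by (rule prob_space_PiM[OF M])
  have "distr (PiM I M) (PiM I M) (\<lambda>\<omega>. \<lambda>i\<in>I. \<omega> i) = distr (PiM I M) (PiM I M) (\<lambda>\<omega>. \<omega>)"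
    by (rule distr_cong) (auto simp: space_PiM PiE_def extensional_restrict)
  also have "\<dots> = (\<Pi>\<^sub>M i\<in>I. distr (PiM I M) (M i) (\<lambda>\<omega>. \<omega> i))"
    by (auto simp: distr_PiM_component[of I M, OF M] intro!: PiM_cong)
  finally show ?thesis
    using False by (subst indep_vars_iff_distr_eq_PiM') auto
qed

text \<open>Change of variables along the projection to coordinate \<open>j\<close>, whose law is
  \<open>M j\<close>.\<close>

lemma
  fixes f :: "'a \<Rightarrow> real"
  assumes M: "\<And>i. i \<in> I \<Longrightarrow> prob_space (M i)" and j: "j \<in> I" and f: "f \<in> borel_measurable (M j)"
  shows integral_PiM_component: "(\<integral>\<omega>. f (\<omega> j) \<partial>PiM I M) = (\<integral>z. f z \<partial>M j)"
    and integrable_PiM_component: "integrable (PiM I M) (\<lambda>\<omega>. f (\<omega> j)) \<longleftrightarrow> integrable (M j) f"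
proof -
  have meas: "(\<lambda>\<omega>. \<omega> j) \<in> measurable (PiM I M) (M j)"
    using j by simp
  show "(\<integral>\<omega>. f (\<omega> j) \<partial>PiM I M) = (\<integral>z. f z \<partial>M j)"
    using integral_distr[OF meas f] distr_PiM_component[of I M j, OF M j] by simp
  show "integrable (PiM I M) (\<lambda>\<omega>. f (\<omega> j)) \<longleftrightarrow> integrable (M j) f"
    using integrable_distr_eq[OF meas f] distr_PiM_component[of I M j, OF M j] by simp
qed

lemma distributed_PiM_component:
  assumes M: "\<And>i. i \<in> I \<Longrightarrow> prob_space (M i)" and j: "j \<in> I" and f: "distributed (M j) L f g"
  shows "distributed (PiM I M) L (\<lambda>\<omega>. f (\<omega> j)) g"
proof -
  have [measurable]: "(\<lambda>\<omega>. \<omega> j) \<in> measurable (PiM I M) (M j)"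
    using j by simp
  have [measurable]: "f \<in> measurable (M j) L"
    using f by (simp add: distributed_def)
  have "distr (PiM I M) L (\<lambda>\<omega>. f (\<omega> j)) = distr (distr (PiM I M) (M j) (\<lambda>\<omega>. \<omega> j)) L f"
    by (subst distr_distr) (auto simp: comp_def)
  then show ?thesis
    using f distr_PiM_component[of I M j, OF M j] by (simp add: distributed_def)
qed

text \<open>Positive variance excludes the point-mass branch of \<open>normal_law\<close>, so the
  functional has a genuine density.\<close>

lemma multivariate_normal_inner:
  assumes M: "multivariate_normal M m V" and u: "u \<bullet> (V *v u) > 0"
  shows "distributed M lborel (\<lambda>z. u \<bullet> z) (normal_density (u \<bullet> m) (sqrt (u \<bullet> (V *v u))))"
proof -
  have [measurable_cong]: "sets M = sets borel"
    using M by (simp add: multivariate_normal_def)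
  have "distr M lborel (\<lambda>z. u \<bullet> z) = distr M borel (\<lambda>z. u \<bullet> z)"
    by (rule distr_cong) auto
  then show ?thesis
    using M u by (simp add: distributed_def multivariate_normal_def normal_law_def)
qed

section \<open>The law of the score and the error rates at a fixed sample size\<close>

lemma score_eq: "score x y S D = (\<Sum>i<S. x \<bullet> D (y, i)) / real S"
  by (simp add: score_def class_mean_def inner_sum_right)

context
  fixes C y :: nat and m :: "nat \<Rightarrow> real^'n" and V :: "real^'n^'n"
    and N :: "nat \<Rightarrow> (real^'n) measure" and x :: "real^'n" and S :: nat
  assumes gauss: "\<And>c. c < C \<Longrightarrow> multivariate_normal (N c) (m c) V"
    and y: "y < C"
    and var_pos: "x \<bullet> (V *v x) > 0"
    and S: "S \<ge> 1"
begin

text \<open>The score is the average of \<open>S\<close> independent normals, the inner products of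
  \<open>x\<close> with the class-\<open>y\<close> examples. Means and variances add under the sum,
  and scaling by \<open>1 / real S\<close> leaves variance
  \<open>x \<bullet> (V *v x) / real S\<close>.\<close>

lemma score_out_distributed:
  "distributed (out_data C N S) lborel (score x y S)
     (normal_density (x \<bullet> m y) (sqrt (x \<bullet> (V *v x) / real S)))"
proof -
  let ?I = "{..<C} \<times> {..<S}" and ?M = "\<lambda>(c, i). N c"
  let ?J = "Pair y ` {..<S}" and ?v = "x \<bullet> (V *v x)"
  have prob: "prob_space (?M j)" if "j \<in> ?I" for j
    using gauss that by (auto simp: multivariate_normal_def)
  interpret prob_space "PiM ?I ?M" by (rule prob_space_PiM[OF prob])
  have sets_M: "sets (?M j) = sets borel" if "j \<in> ?I" for j
    using gauss that by (auto simp: multivariate_normal_def)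
  have J: "?J \<subseteq> ?I" using y by auto
  have "indep_vars (\<lambda>_. borel) (\<lambda>j D. x \<bullet> D j) ?I"
  proof (rule indep_vars_compose2[where M' = ?M and Y = "\<lambda>_ z. x \<bullet> z"])
    show "indep_vars ?M (\<lambda>j D. D j) ?I" by (rule indep_vars_PiM_components[OF prob])
    show "(\<lambda>z. x \<bullet> z) \<in> measurable (?M j) borel" if "j \<in> ?I" for j
      unfolding measurable_cong_sets[OF sets_M[OF that] refl] by simp
  qed
  \<comment> \<open>Only the positions of class \<open>y\<close> enter the score; independence
    passes to this subfamily.\<close>
  then have indep: "indep_vars (\<lambda>_. borel) (\<lambda>j D. x \<bullet> D j) ?J"
    using J by (rule indep_vars_subset)
  have "distributed (PiM ?I ?M) lborel (\<lambda>D. \<Sum>j\<in>?J. x \<bullet> D j)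
     (normal_density (\<Sum>j\<in>?J. x \<bullet> m y) (sqrt (\<Sum>j\<in>?J. (sqrt ?v)\<^sup>2)))"
  proof (rule sum_indep_normal[OF _ _ indep])
    show "?J \<noteq> {}" using S by (simp add: lessThan_empty_iff)
    show "distributed (PiM ?I ?M) lborel (\<lambda>D. x \<bullet> D j) (normal_density (x \<bullet> m y) (sqrt ?v))"
      if "j \<in> ?J" for j
    proof (rule distributed_PiM_component[OF prob])
      show "j \<in> ?I" using that J by auto
      show "distributed (?M j) lborel (\<lambda>z. x \<bullet> z) (normal_density (x \<bullet> m y) (sqrt ?v))"
        using multivariate_normal_inner[OF gauss[OF y] var_pos] that by auto
    qed
  qed (use var_pos in auto)
  also have "(\<lambda>D. \<Sum>j\<in>?J. x \<bullet> D j) = (\<lambda>D. \<Sum>i<S. x \<bullet> D (y, i))"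
    by (simp add: sum.reindex inj_on_def)
  finally have "distributed (PiM ?I ?M) lborel (\<lambda>D. \<Sum>i<S. x \<bullet> D (y, i))
     (normal_density (real S * (x \<bullet> m y)) (sqrt (real S * ?v)))"
    by (simp add: card_image inj_on_def less_imp_le[OF var_pos])
  from normal_density_affine[OF this, of "1 / real S" 0]
  have "distributed (PiM ?I ?M) lborel (score x y S)
     (normal_density (x \<bullet> m y) (sqrt (real S * ?v) / real S))"
    using var_pos S by (simp add: score_eq[abs_def])
  also have "sqrt (real S * ?v) / real S = sqrt (?v / real S)"
    using S by (simp add: real_sqrt_mult real_sqrt_divide field_simps)
  finally show ?thesis
    by (simp add: out_data_def)
qed

lemma mu_out_eq: "mu_out C N x y S = x \<bullet> m y"
  and score_sd_eq: "score_sd C N x y S = sqrt (x \<bullet> (V *v x) / real S)"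
proof -
  have pos: "0 < sqrt (x \<bullet> (V *v x) / real S)"
    using var_pos S by simp
  interpret prob_space "out_data C N S"
    unfolding out_data_def using gauss
    by (intro prob_space_PiM) (auto simp: multivariate_normal_def)
  show "mu_out C N x y S = x \<bullet> m y"
    using normal_distributed_expectation[OF pos score_out_distributed] by (simp add: mu_out_def)
  show "score_sd C N x y S = sqrt (x \<bullet> (V *v x) / real S)"
    using normal_distributed_variance[OF pos score_out_distributed] var_pos
    by (simp add: score_sd_def mu_out_def)
qed

text \<open>By linearity of the expectation, the position \<open>(y, 0)\<close> contributes
  \<open>x \<bullet> x\<close> and each of the other \<open>S - 1\<close> positions of class
  \<open>y\<close> contributes \<open>x \<bullet> m y\<close>.\<close>

lemma mu_in_eq: "mu_in C N x y S = x \<bullet> m y + x \<bullet> (x - m y) / real S"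
proof -
  let ?I = "{..<C} \<times> {..<S}" and ?M = "\<lambda>(c, i). if (c, i) = (y, 0) then return borel x else N c"
  have prob: "prob_space (?M j)" if "j \<in> ?I" for j
    using gauss that by (auto simp: multivariate_normal_def prob_space_return)
  have sets_M: "sets (?M j) = sets borel" if "j \<in> ?I" for j
    using gauss that by (auto simp: multivariate_normal_def split: if_splits)
  have meas: "(\<lambda>z. x \<bullet> z) \<in> borel_measurable (?M j)" if "j \<in> ?I" for j
    unfolding measurable_cong_sets[OF sets_M[OF that] refl] by simp
  have fresh: "integrable (N y) (\<lambda>z. x \<bullet> z)" "(\<integral>z. x \<bullet> z \<partial>N y) = x \<bullet> m y"
  proof -
    interpret prob_space "N y" using gauss[OF y] by (simp add: multivariate_normal_def)
    note D = multivariate_normal_inner[OF gauss[OF y] var_pos]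
    show "integrable (N y) (\<lambda>z. x \<bullet> z)"
      using var_pos by (intro distributed_integrable_var[OF D] integrable_normal_moment_nz_1) auto
    show "(\<integral>z. x \<bullet> z \<partial>N y) = x \<bullet> m y"
      using normal_distributed_expectation[OF _ D] var_pos by simp
  qed
  have ret: "integrable (return borel x) (\<lambda>z. x \<bullet> z)" "(\<integral>z. x \<bullet> z \<partial>return borel x) = x \<bullet> x"
    by (auto simp: integral_return intro!: integrable_iff_bounded[THEN iffD2] simp: nn_integral_return)
  have I: "(y, i) \<in> ?I" if "i < S" for i
    using y that by simp
  note component = integral_PiM_component[where M = ?M and I = ?I and f = "\<lambda>z. x \<bullet> z"]
    integrable_PiM_component[where M = ?M and I = ?I and f = "\<lambda>z. x \<bullet> z"]
  have int: "integrable (PiM ?I ?M) (\<lambda>D. x \<bullet> D (y, i))" if "i < S" for i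
  proof (rule component(2)[THEN iffD2, OF prob I[OF that] meas[OF I[OF that]]])
    show "integrable (?M (y, i)) (\<lambda>z. x \<bullet> z)"
      using fresh ret by simp
  qed
  have "mu_in C N x y S = (\<integral>D. (\<Sum>i<S. x \<bullet> D (y, i)) \<partial>PiM ?I ?M) / real S"
    by (simp add: mu_in_def in_data_def score_eq)
  also have "(\<integral>D. (\<Sum>i<S. x \<bullet> D (y, i)) \<partial>PiM ?I ?M) = (\<Sum>i<S. \<integral>D. x \<bullet> D (y, i) \<partial>PiM ?I ?M)"
    using int by (intro Bochner_Integration.integral_sum) auto
  \<comment> \<open>Every summand gets the fresh-example mean, with the correction for the planted
    example only at index 0.\<close>
  also have "\<dots> = (\<Sum>i<S. x \<bullet> m y + (if i = 0 then x \<bullet> (x - m y) else 0))"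
  proof (rule sum.cong)
    fix i assume "i \<in> {..<S}"
    then have "i < S" by simp
    have "(\<integral>D. x \<bullet> D (y, i) \<partial>PiM ?I ?M) = (\<integral>z. x \<bullet> z \<partial>?M (y, i))"
      by (rule component(1)[OF prob I[OF \<open>i < S\<close>] meas[OF I[OF \<open>i < S\<close>]]])
    then show "(\<integral>D. x \<bullet> D (y, i) \<partial>PiM ?I ?M) = x \<bullet> m y + (if i = 0 then x \<bullet> (x - m y) else 0)"
      using fresh ret by (simp add: inner_diff_right)
  qed simp
  also have "\<dots> = real S * (x \<bullet> m y) + x \<bullet> (x - m y)"
    using S by (simp add: sum.distrib)
  finally show ?thesis
    using S by (simp add: field_simps)
qed

text \<open>Acceptance is a half-line in the standardized score, so both rates are values of the
  cdf. Passing from the OUT to the IN law moves the argument by the standardized distance of the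
  means, whatever the threshold.\<close>

lemma LiRA_rates:
  assumes nz: "x \<bullet> (x - m y) \<noteq> 0" and FPR: "FPR_LiRA C N x y S \<tau> < 1"
  obtains z where "FPR_LiRA C N x y S \<tau> = std_normal_cdf z"
    and "TPR_LiRA C N x y S \<tau> =
      std_normal_cdf (z + \<bar>x \<bullet> (x - m y)\<bar> / sqrt (x \<bullet> (V *v x)) / sqrt (real S))"
proof -
  define \<mu> \<sigma> \<mu>' where "\<mu> = x \<bullet> m y" and "\<sigma> = sqrt (x \<bullet> (V *v x) / real S)"
    and "\<mu>' = mu_in C N x y S"
  define a where "a = (\<mu>' - \<mu>) / \<sigma>"
  have \<sigma>: "\<sigma> > 0"
    using var_pos S by (simp add: \<sigma>_def)
  \<comment> \<open>The mean gap carries a factor 1/S and the scale a factor 1/sqrt S; their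
    quotient \<open>a\<close> keeps a single 1/sqrt S. It is signed: either orientation of the test
    can occur.\<close>
  have "real S = sqrt (real S) * sqrt (real S)" by simp
  then have a_eq: "a = x \<bullet> (x - m y) / sqrt (x \<bullet> (V *v x)) / sqrt (real S)"
    using var_pos S unfolding a_def \<mu>'_def mu_in_eq \<mu>_def \<sigma>_def real_sqrt_divide
    by (simp add: field_simps)
  have a: "a \<noteq> 0"
    using nz var_pos S by (simp add: a_eq)
  have ratio: "lira_ratio C N x y S t = exp (a * ((t - \<mu>) / \<sigma>) - a\<^sup>2 / 2)" for t
    unfolding lira_ratio_def mu_out_eq score_sd_eq a_def
    using normal_likelihood_ratio[OF \<sigma>, of \<mu>' t \<mu>] by (simp add: \<mu>_def \<sigma>_def \<mu>'_def)
  have meas: "score x y S \<in> measurable (out_data C N S) lborel"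
    using score_out_distributed by (simp add: distributed_def)
  have law: "distr (out_data C N S) lborel (score x y S) = density lborel (normal_density \<mu> \<sigma>)"
    using score_out_distributed by (simp add: distributed_def \<mu>_def \<sigma>_def)
  have ratio_set: "{t. \<tau> \<le> lira_ratio C N x y S t} \<in> sets lborel"
    unfolding ratio by measurable
  have FPR_eq: "FPR_LiRA C N x y S \<tau> =
      measure (density lborel (normal_density \<mu> \<sigma>)) {t. \<tau> \<le> lira_ratio C N x y S t}"
    unfolding law[symmetric] measure_distr[OF meas ratio_set] FPR_LiRA_def
    by (simp add: vimage_def Int_def conj_commute)
  \<comment> \<open>A threshold at or below 0 would accept every score and force the FPR to be 1.
    Positivity allows taking logarithms in the test.\<close>
  have "\<tau> > 0"
  proof (rule ccontr)
    assume "\<not> \<tau> > 0"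
    then have "{t. \<tau> \<le> lira_ratio C N x y S t} = space (density lborel (normal_density \<mu> \<sigma>))"
      by (auto simp: ratio intro: order_trans[OF _ less_imp_le[OF exp_gt_zero]])
    then show False
      using FPR FPR_eq prob_space.prob_space[OF prob_space_normal_density[OF \<sigma>, of \<mu>]] by simp
  qed
  then have ratio_iff: "\<tau> \<le> lira_ratio C N x y S t \<longleftrightarrow> ln \<tau> + a\<^sup>2 / 2 \<le> a * ((t - \<mu>) / \<sigma>)" for t
    unfolding ratio by (subst ln_le_cancel_iff[symmetric]) (auto simp: algebra_simps)
  define b where "b = ln \<tau> + a\<^sup>2 / 2"
  \<comment> \<open>Recentring at the IN mean changes the bound from \<open>b\<close> to
    \<open>b - a\<^sup>2\<close>; after division by \<open>- \<bar>a\<bar>\<close> the cdf argument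
    grows by exactly \<open>\<bar>a\<bar>\<close>.\<close>
  have shift: "a * ((t - \<mu>) / \<sigma>) = a * ((t - \<mu>') / \<sigma>) + a\<^sup>2" for t
    using \<sigma> by (simp add: a_def field_simps power2_eq_square)
  have "FPR_LiRA C N x y S \<tau> = std_normal_cdf (- b / \<bar>a\<bar>)"
    unfolding FPR_eq ratio_iff b_def by (rule measure_normal_halfline[OF \<sigma> a])
  moreover have "TPR_LiRA C N x y S \<tau> = std_normal_cdf (- (b - a\<^sup>2) / \<bar>a\<bar>)"
  proof -
    have "TPR_LiRA C N x y S \<tau> =
        measure (density lborel (normal_density \<mu>' \<sigma>)) {t. b - a\<^sup>2 \<le> a * ((t - \<mu>') / \<sigma>)}"
      using \<sigma> unfolding TPR_LiRA_def score_sd_eq \<sigma>_def[symmetric] \<mu>'_def[symmetric] ratio_iff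
        b_def[symmetric] shift diff_le_eq normal_law_def by simp
    also have "\<dots> = std_normal_cdf (- (b - a\<^sup>2) / \<bar>a\<bar>)"
      by (rule measure_normal_halfline[OF \<sigma> a])
    finally show ?thesis .
  qed
  moreover have "- (b - a\<^sup>2) / \<bar>a\<bar> = - b / \<bar>a\<bar> + \<bar>a\<bar>"
    using a by (simp add: field_simps power2_eq_square)
  moreover have "\<bar>a\<bar> = \<bar>x \<bullet> (x - m y)\<bar> / sqrt (x \<bullet> (V *v x)) / sqrt (real S)"
    using var_pos by (simp add: a_eq abs_mult)
  ultimately show ?thesis
    using that by metis
qed

end

section \<open>The expansion of the log-gap as \<open>S\<close> grows\<close>

theorem theorem2:
  fixes C y :: nat
    and m :: "nat \<Rightarrow> real^'n"
    and V :: "real^'n^'n"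
    and N :: "nat \<Rightarrow> (real^'n) measure"
    and x :: "real^'n"
    and \<alpha> :: real
    and \<tau> :: "nat \<Rightarrow> real"
  assumes unit: "\<And>c. c < C \<Longrightarrow> norm (m c) = 1"
    and orth: "\<And>c c'. c < C \<Longrightarrow> c' < C \<Longrightarrow> c \<noteq> c' \<Longrightarrow> m c \<bullet> m c' = 0"
    and cov: "covariance_matrix V"
    and gauss: "\<And>c. c < C \<Longrightarrow> multivariate_normal (N c) (m c) V"
    and y: "y < C"
    and var_pos: "x \<bullet> (V *v x) > 0"
    and nz: "x \<bullet> (x - m y) \<noteq> 0"
    and \<alpha>: "0 < \<alpha>" "\<alpha> < 1"
    and FPR: "\<And>S. S \<ge> 1 \<Longrightarrow> FPR_LiRA C N x y S (\<tau> S) = \<alpha>"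
  shows "(\<exists>\<xi> :: nat \<Rightarrow> real. \<xi> \<in> O(\<lambda>S. 1 / sqrt (real S)) \<and>
            (\<forall>S\<ge>1. TPR_LiRA C N x y S (\<tau> S) - FPR_LiRA C N x y S (\<tau> S) > 0 \<and> 1 + \<xi> S > 0 \<and>
               ln (TPR_LiRA C N x y S (\<tau> S) - FPR_LiRA C N x y S (\<tau> S)) =
                 - (1/2) * ln (real S)
                 - (1/2) * (inv std_normal_cdf (FPR_LiRA C N x y S (\<tau> S)))\<^sup>2
                 + ln (\<bar>x \<bullet> (x - m y)\<bar> / (sqrt (x \<bullet> (V *v x)) * sqrt (2 * pi)))
                 + ln (1 + \<xi> S)))
       \<and> (\<lambda>S. ln (TPR_LiRA C N x y S (\<tau> S) - FPR_LiRA C N x y S (\<tau> S))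
              - (- (1/2) * ln (real S)
                 - (1/2) * (inv std_normal_cdf (FPR_LiRA C N x y S (\<tau> S)))\<^sup>2
                 + ln (\<bar>x \<bullet> (x - m y)\<bar> / (sqrt (x \<bullet> (V *v x)) * sqrt (2 * pi)))))
           \<longlonglongrightarrow> 0"
proof -
  define k where "k = \<bar>x \<bullet> (x - m y)\<bar> / sqrt (x \<bullet> (V *v x))"
  have k: "k > 0"
    using nz var_pos by (simp add: k_def)
  define z where "z = inv std_normal_cdf \<alpha>"
  define \<phi> where "\<phi> = std_normal_density z"
  define a where "a S = k / sqrt (real S)" for S :: nat
  \<comment> \<open>The relative error of the first-order approximation \<open>a S * \<phi>\<close>
    to the gap; with this choice the expansion is an exact identity.\<close>
  define \<xi> where "\<xi> S = (TPR_LiRA C N x y S (\<tau> S) - \<alpha>) / (a S * \<phi>) - 1" for S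
  have \<phi>: "\<phi> > 0"
    unfolding \<phi>_def by (rule normal_density_pos) simp
  have rates: "0 < a S \<and> 0 < 1 + \<xi> S \<and> \<bar>\<xi> S\<bar> \<le> a S / \<phi> \<and>
      TPR_LiRA C N x y S (\<tau> S) - \<alpha> = a S * \<phi> * (1 + \<xi> S)" if S: "S \<ge> 1" for S
  proof -
    have "FPR_LiRA C N x y S (\<tau> S) < 1"
      using FPR[OF S] \<alpha> by simp
    from LiRA_rates[of C N m V y x S, OF gauss y var_pos S nz this]
    obtain z' where z': "FPR_LiRA C N x y S (\<tau> S) = std_normal_cdf z'"
      "TPR_LiRA C N x y S (\<tau> S) = std_normal_cdf (z' + a S)"
      unfolding a_def k_def by blast
    \<comment> \<open>The threshold may vary with \<open>S\<close>, but the FPR is always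
      \<open>\<alpha>\<close>, so by injectivity the same quantile \<open>z\<close> serves every
      \<open>S\<close>.\<close>
    have "z' = z"
      using z'(1) FPR[OF S] strict_mono_imp_inj_on[OF std_normal_cdf_strict_mono]
      by (simp add: z_def inv_f_f)
    have a: "a S > 0"
      using k S by (simp add: a_def)
    then have "z < z + a S" by simp
    then obtain t where t: "z < t" "t < z + a S"
      and "std_normal_cdf (z + a S) - std_normal_cdf z = (z + a S - z) * std_normal_density t"
      by (rule std_normal_cdf_mvt)
    then have gap: "TPR_LiRA C N x y S (\<tau> S) - \<alpha> = a S * std_normal_density t"
      using z' FPR[OF S] \<open>z' = z\<close> by simp
    \<comment> \<open>Thus \<open>1 + \<xi> S\<close> is a ratio of two density values, hence
      positive, and the Lipschitz bound over a distance below \<open>a S\<close> controls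
      \<open>\<xi> S\<close>.\<close>
    then have \<xi>_eq: "\<xi> S = std_normal_density t / \<phi> - 1"
      using a by (simp add: \<xi>_def)
    have "\<xi> S = (std_normal_density t - \<phi>) / \<phi>"
      using \<phi> by (simp add: \<xi>_eq field_simps)
    moreover have "\<bar>std_normal_density t - \<phi>\<bar> \<le> a S"
      using std_normal_density_lipschitz[of t z] t by (simp add: \<phi>_def)
    ultimately have "\<bar>\<xi> S\<bar> \<le> a S / \<phi>"
      using \<phi> by (simp add: divide_right_mono)
    then show ?thesis
      using a gap \<phi> normal_density_pos[of 1 0 t] by (simp add: \<xi>_eq)
  qed
  define R where "R S = - (1/2) * ln (real S) - (1/2) * (inv std_normal_cdf (FPR_LiRA C N x y S (\<tau> S)))\<^sup>2
      + ln (\<bar>x \<bullet> (x - m y)\<bar> / (sqrt (x \<bullet> (V *v x)) * sqrt (2 * pi)))" for S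
  have expansion: "TPR_LiRA C N x y S (\<tau> S) - FPR_LiRA C N x y S (\<tau> S) > 0 \<and> 1 + \<xi> S > 0 \<and>
      ln (TPR_LiRA C N x y S (\<tau> S) - FPR_LiRA C N x y S (\<tau> S)) = R S + ln (1 + \<xi> S)"
    if S: "S \<ge> 1" for S
  proof -
    \<comment> \<open>The logarithm of the first-order term is exactly the main part
      \<open>R S\<close>: \<open>a S\<close> supplies the term in \<open>ln (real S)\<close>, and
      the exponent of the density supplies the squared quantile.\<close>
    have "ln (a S * \<phi>) = ln (k / sqrt (2 * pi) * exp (- z\<^sup>2 / 2) / sqrt (real S))"
      by (simp add: a_def \<phi>_def std_normal_density_def mult.commute)
    also have "\<dots> = ln (k / sqrt (2 * pi)) - z\<^sup>2 / 2 - ln (real S) / 2"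
      using k S by (simp add: ln_mult ln_div ln_sqrt)
    also have "\<dots> = R S"
      unfolding R_def FPR[OF S] by (simp add: k_def z_def)
    finally have "ln (a S * \<phi>) = R S" .
    then show ?thesis
      using rates[OF S] \<phi> by (simp add: FPR[OF S] ln_mult)
  qed
  \<comment> \<open>The constant \<open>k / \<phi>\<close> is free of \<open>S\<close>, so one bound
    serves both the order estimate and the limit.\<close>
  have bound: "\<forall>\<^sub>F S in sequentially. norm (\<xi> S) \<le> k / \<phi> * (1 / sqrt (real S))"
    using eventually_ge_at_top[of 1] by eventually_elim (use rates in \<open>simp add: a_def mult.commute\<close>)
  then have bigo: "\<xi> \<in> O(\<lambda>S. 1 / sqrt (real S))"
    by (intro bigoI[of _ "k / \<phi>"]) simp
  have "(\<lambda>S. 1 / sqrt (real S)) \<longlonglongrightarrow> 0"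
    by real_asymp
  then have "\<xi> \<longlonglongrightarrow> 0"
    by (intro Lim_null_comparison[OF bound] tendsto_mult_right_zero)
  \<comment> \<open>Continuity of \<open>ln\<close> at 1 turns the vanishing relative error into a
    vanishing difference of logarithms.\<close>
  then have lim: "(\<lambda>S. ln (1 + \<xi> S)) \<longlonglongrightarrow> ln (1 + 0)"
    by (intro tendsto_intros) auto
  have ev: "\<forall>\<^sub>F S in sequentially. ln (1 + \<xi> S) =
      ln (TPR_LiRA C N x y S (\<tau> S) - FPR_LiRA C N x y S (\<tau> S)) - R S"
    using eventually_ge_at_top[of 1] by eventually_elim (simp add: expansion)
  have "(\<lambda>S. ln (TPR_LiRA C N x y S (\<tau> S) - FPR_LiRA C N x y S (\<tau> S)) - R S) \<longlonglongrightarrow> 0"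
    using Lim_transform_eventually[OF lim ev] by simp
  with bigo expansion show ?thesis
    unfolding R_def by blast
qed

end
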